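(* For every integer $k\geq1$ there are constants $K=K(k)>0$ and $N=N(k)>0$ such that the following holds. Let $G$ be a group, $c\geq 1$, and let $A\subseteq G$ be a finite nonempty $k$-stable set with $|AA^{-1}A|\leq c|A|$. Then for every $0<\epsilon\leq\frac12$ there is a subgroup $H\leq G$ such that: (i) $H\subseteq A^{-1}A$ and $A\subseteq CH$ for some $C\subseteq A$ with $|C|\leq K(c\epsilon^{-1})^{N}$; (ii) there is a set $D\subseteq C$ such that $|A\triangle DH|<\epsilon|H|$.
   Context: A subset $A$ of a group $G$ is $k$-stable if there do not exist $a_1,\ldots,a_k,b_1,\ldots,b_k\in G$ with $a_ib_j\in A$ iff $i\leq j$. Products of sets are $XY=\{xy:x\in X,y\in Y\}$, $A^{-1}=\{a^{-1}:a\in A\}$. *)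

theory Defs
  imports Complex_Main "HOL-Algebra.Coset"
begin

definition k_stable :: "('a, 'b) monoid_scheme \<Rightarrow> nat \<Rightarrow> 'a set \<Rightarrow> bool" where
  "k_stable G k A \<longleftrightarrow>
     \<not> (\<exists>a b :: nat \<Rightarrow> 'a.
          (\<forall>i\<in>{1..k}. a i \<in> carrier G \<and> b i \<in> carrier G) \<and>
          (\<forall>i\<in>{1..k}. \<forall>j\<in>{1..k}. a i \<otimes>\<^bsub>G\<^esub> b j \<in> A \<longleftrightarrow> i \<le> j))"

text \<open>
  The constants have to depend on \<open>k\<close> alone, and be the same for the groups over all types.
  An existential quantifier inside a theorem about groups over a type variable \<open>'a\<close> would let
  them depend on \<open>'a\<close>. They are therefore introduced as global constants. No HOL formula
  quantifies over types, so they are chosen to be suitable for all groups with elements in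
  \<^typ>\<open>nat\<close>. This loses nothing: a pair suitable for those is suitable for every group, because
  the claim for a finite set \<open>A\<close> only concerns the countable subgroup generated by \<open>A\<close>.
\<close>

definition suitable_consts :: "('a, 'b) monoid_scheme \<Rightarrow> nat \<Rightarrow> real \<Rightarrow> real \<Rightarrow> bool" where
  "suitable_consts G k K N \<longleftrightarrow>
     (\<forall>(c::real) A. c \<ge> 1 \<longrightarrow> A \<subseteq> carrier G \<longrightarrow> finite A \<longrightarrow> A \<noteq> {} \<longrightarrow> k_stable G k A \<longrightarrow>
        real (card (A <#>\<^bsub>G\<^esub> set_inv\<^bsub>G\<^esub> A <#>\<^bsub>G\<^esub> A)) \<le> c * real (card A) \<longrightarrow>
        (\<forall>\<epsilon>::real. 0 < \<epsilon> \<longrightarrow> \<epsilon> \<le> 1 / 2 \<longrightarrow>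
           (\<exists>H. subgroup H G \<and> H \<subseteq> set_inv\<^bsub>G\<^esub> A <#>\<^bsub>G\<^esub> A \<and>
              (\<exists>C\<subseteq>A. A \<subseteq> C <#>\<^bsub>G\<^esub> H \<and> real (card C) \<le> K * (c * inverse \<epsilon>) powr N \<and>
                 (\<exists>D\<subseteq>C. real (card (sym_diff A (D <#>\<^bsub>G\<^esub> H))) < \<epsilon> * real (card H))))))"

definition stable_consts :: "nat \<Rightarrow> real \<times> real" where
  "stable_consts k =
     (SOME (K, N). K > 0 \<and> N > 0 \<and> (\<forall>G :: nat monoid. group G \<longrightarrow> suitable_consts G k K N))"

definition stable_K :: "nat \<Rightarrow> real" where
  "stable_K k = fst (stable_consts k)"

definition stable_N :: "nat \<Rightarrow> real" where
  "stable_N k = snd (stable_consts k)"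

end

theory Submission
  imports Defs "HOL-Algebra.Generated_Groups" "HOL-Library.Countable_Set"
begin

text \<open>
  A \<open>k\<close>-stable \<open>A\<close> admits no tall binary tree of splittings by left translates of \<open>A\<close>. Splitting
  \<open>A\<close> as long as possible thus stops, after a number of steps bounded in terms of \<open>k\<close>, at a set
  \<open>Y \<subseteq> A\<close> of density \<open>\<eta>\<close>, polynomial in \<open>\<epsilon> / c\<close>, which every translate of \<open>A\<close> almost contains or
  almost avoids, with an error that is small even compared to \<open>\<eta>\<close>.

  Let \<open>P\<close> be the set of \<open>g\<close> such that \<open>gY\<close> is almost contained in \<open>A\<close>, and \<open>H\<close> the right
  stabiliser of \<open>P\<close>, an exact subgroup. If \<open>gH \<noteq> hH\<close>, then some translate of \<open>A\<close> separates
  \<open>gY\<close> from \<open>hY\<close>, so these sets are almost disjoint. As they lie in \<open>A A\<inverse> A\<close> for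
  \<open>g, h \<in> A A\<inverse>\<close>, at most \<open>2 c / \<eta>\<close> left cosets of \<open>H\<close> meet \<open>A A\<inverse>\<close>. Counting the pairs
  \<open>(g, y)\<close> for which \<open>gy \<in> A\<close> and \<open>g \<in> P\<close> disagree yields \<open>y \<in> Y\<close> such that \<open>A\<close> is close to
  \<open>Py\<close>, which is a union of left cosets of \<open>y\<inverse> H y\<close>.
\<close>

section \<open>Binary trees and ladders\<close>

text \<open>The largest such \<open>n\<close> is the Littlestone dimension, or Shelah 2-rank, of
  \<open>R\<close> on \<open>Y\<close>. The label set \<open>S\<close> is a parameter because the
  colouring argument restricts the labels.\<close>

primrec splitting_tree :: "('a \<Rightarrow> 'b \<Rightarrow> bool) \<Rightarrow> 'a set \<Rightarrow> nat \<Rightarrow> 'b set \<Rightarrow> bool" where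
  "splitting_tree R S 0 Y \<longleftrightarrow> Y \<noteq> {}"
| "splitting_tree R S (Suc n) Y \<longleftrightarrow>
     (\<exists>a\<in>S. splitting_tree R S n {b \<in> Y. R a b} \<and> splitting_tree R S n {b \<in> Y. \<not> R a b})"

text \<open>A half-graph, best read as a chain \<open>b 0, a 1, b 1, ..., a r, b r\<close> in which
  \<open>R\<close> holds iff the \<open>a\<close> comes before the \<open>b\<close>. The extra
  \<open>b 0\<close> puts a \<open>b\<close> at both ends, so that the chain can grow at either of
  them.\<close>

definition ladder :: "('a \<Rightarrow> 'b \<Rightarrow> bool) \<Rightarrow> 'a set \<Rightarrow> 'b set \<Rightarrow> nat \<Rightarrow> bool" where
  "ladder R S Y r \<longleftrightarrow>
     (\<exists>a b. (\<forall>i\<in>{1..r}. a i \<in> S) \<and> (\<forall>j\<le>r. b j \<in> Y) \<and>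
        (\<forall>i\<in>{1..r}. \<forall>j\<le>r. R (a i) (b j) \<longleftrightarrow> i \<le> j))"

lemma splitting_tree_mono:
  "splitting_tree R S n Y \<Longrightarrow> Y \<subseteq> Y' \<Longrightarrow> splitting_tree R S n Y'"
proof (induction n arbitrary: Y Y')
  case 0
  then show ?case by auto
next
  case (Suc n)
  then obtain a where a: "a \<in> S" "splitting_tree R S n {b \<in> Y. R a b}"
      "splitting_tree R S n {b \<in> Y. \<not> R a b}"
    by auto
  have "{b \<in> Y. R a b} \<subseteq> {b \<in> Y'. R a b}" "{b \<in> Y. \<not> R a b} \<subseteq> {b \<in> Y'. \<not> R a b}"
    using Suc.prems by auto
  from Suc.IH[OF a(2) this(1)] Suc.IH[OF a(3) this(2)] a(1) show ?case by auto
qed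

lemma splitting_tree_nonempty: "splitting_tree R S n Y \<Longrightarrow> Y \<noteq> {}"
proof (induction n arbitrary: Y)
  case (Suc n)
  then obtain a where "splitting_tree R S n {b \<in> Y. R a b}" by auto
  from Suc.IH[OF this] show ?case by blast
qed simp

text \<open>A Ramsey property of trees. If the root label lies in \<open>S\<close>, then by
  induction each child has a tree of height \<open>n - 1\<close> over \<open>S\<close> or one of
  height \<open>m\<close> over \<open>S'\<close>. One of the second kind suffices; two of the first
  kind are joined by the root. The other case is symmetric.\<close>

lemma splitting_tree_colour:
  assumes "splitting_tree R (S \<union> S') (n + m) Y"
  shows "splitting_tree R S n Y \<or> splitting_tree R S' m Y"
  using assms
proof (induction "n + m" arbitrary: n m Y)
  case 0
  then show ?case by simp
next
  case (Suc l)
  have ne: "Y \<noteq> {}" using Suc.prems splitting_tree_nonempty by blast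
  have "splitting_tree R (S \<union> S') (Suc l) Y" using Suc by simp
  then obtain a where a: "a \<in> S \<union> S'" "splitting_tree R (S \<union> S') l {b \<in> Y. R a b}"
      "splitting_tree R (S \<union> S') l {b \<in> Y. \<not> R a b}"
    by auto
  have sub: "{b \<in> Y. R a b} \<subseteq> Y" "{b \<in> Y. \<not> R a b} \<subseteq> Y" by auto
  show ?case
  proof (cases "n = 0 \<or> m = 0")
    case True
    with ne show ?thesis by auto
  next
    case False
    then obtain n' m' where nm: "n = Suc n'" "m = Suc m'" by (meson not0_implies_Suc)
    show ?thesis
    proof (cases "a \<in> S")
      case True
      have l: "l = n' + m" using Suc nm by simp
      have "splitting_tree R S n' {b \<in> Y. R a b} \<or> splitting_tree R S' m Y"
        using Suc.hyps(1)[OF l, of "{b \<in> Y. R a b}"] a(2) l splitting_tree_mono[OF _ sub(1)] by blast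
      moreover have "splitting_tree R S n' {b \<in> Y. \<not> R a b} \<or> splitting_tree R S' m Y"
        using Suc.hyps(1)[OF l, of "{b \<in> Y. \<not> R a b}"] a(3) l splitting_tree_mono[OF _ sub(2)] by blast
      ultimately show ?thesis using True nm(1) by auto
    next
      case F: False
      with a have aS: "a \<in> S'" by simp
      have l: "l = n + m'" using Suc nm by simp
      have "splitting_tree R S n Y \<or> splitting_tree R S' m' {b \<in> Y. R a b}"
        using Suc.hyps(1)[OF l, of "{b \<in> Y. R a b}"] a(2) l splitting_tree_mono[OF _ sub(1)] by blast
      moreover have "splitting_tree R S n Y \<or> splitting_tree R S' m' {b \<in> Y. \<not> R a b}"
        using Suc.hyps(1)[OF l, of "{b \<in> Y. \<not> R a b}"] a(3) l splitting_tree_mono[OF _ sub(2)] by blast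
      ultimately show ?thesis using aS nm(2) by auto
    qed
  qed
qed

text \<open>Continues the chain by \<open>a\<close>, then \<open>b\<close>: \<open>a\<close> comes
  after every old \<open>b j\<close>, and \<open>b\<close> after all of \<open>S'\<close>, which
  contains \<open>a\<close>.\<close>

lemma ladder_append:
  assumes "ladder R S' Y' r" "S' \<subseteq> S" "Y' \<subseteq> Y" "a \<in> S'" "b \<in> Y"
    and "\<And>x. x \<in> S' \<Longrightarrow> R x b" "\<And>z. z \<in> Y' \<Longrightarrow> \<not> R a z"
  shows "ladder R S Y (Suc r)"
proof -
  obtain f g where fg: "\<And>i. i \<in> {1..r} \<Longrightarrow> f i \<in> S'" "\<And>j. j \<le> r \<Longrightarrow> g j \<in> Y'"
    "\<And>i j. i \<in> {1..r} \<Longrightarrow> j \<le> r \<Longrightarrow> R (f i) (g j) \<longleftrightarrow> i \<le> j"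
    using assms(1) unfolding ladder_def by (elim exE conjE) blast
  define f' where "f' = f(Suc r := a)"
  define g' where "g' = g(Suc r := b)"
  have f': "f' i = a \<and> i = Suc r \<or> i \<in> {1..r} \<and> f' i = f i" if "i \<in> {1..Suc r}" for i
    using that by (auto simp: f'_def)
  have g': "g' j = b \<and> j = Suc r \<or> j \<le> r \<and> g' j = g j" if "j \<le> Suc r" for j
    using that by (auto simp: g'_def)
  show ?thesis
    unfolding ladder_def
  proof (intro exI[of _ f'] exI[of _ g'] conjI ballI allI impI)
    fix i assume "i \<in> {1..Suc r}"
    from f'[OF this] fg(1)[of i] assms(2,4) show "f' i \<in> S" by auto
  next
    fix j assume "j \<le> Suc r"
    from g'[OF this] fg(2)[of j] assms(3,5) show "g' j \<in> Y" by auto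
  next
    fix i j assume "i \<in> {1..Suc r}" "j \<le> Suc r"
    from f'[OF this(1)] g'[OF this(2)] show "R (f' i) (g' j) \<longleftrightarrow> i \<le> j"
      by (elim disjE conjE) (use fg(1,3) assms(4,6) fg(2)[THEN assms(7)] in auto)
  qed
qed

text \<open>Starts the chain with \<open>b\<close>, then \<open>a\<close>: \<open>b\<close> precedes
  all of \<open>S'\<close>, which contains \<open>a\<close>, and \<open>a\<close> precedes every old
  \<open>b j\<close>.\<close>

lemma ladder_prepend:
  assumes "ladder R S' Y' r" "S' \<subseteq> S" "Y' \<subseteq> Y" "a \<in> S'" "b \<in> Y"
    and "\<And>x. x \<in> S' \<Longrightarrow> \<not> R x b" "\<And>z. z \<in> Y' \<Longrightarrow> R a z"
  shows "ladder R S Y (Suc r)"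
proof -
  obtain f g where fg: "\<And>i. i \<in> {1..r} \<Longrightarrow> f i \<in> S'" "\<And>j. j \<le> r \<Longrightarrow> g j \<in> Y'"
    "\<And>i j. i \<in> {1..r} \<Longrightarrow> j \<le> r \<Longrightarrow> R (f i) (g j) \<longleftrightarrow> i \<le> j"
    using assms(1) unfolding ladder_def by (elim exE conjE) blast
  \<comment> \<open>Old indices move up by one. The new \<open>a\<close> gets index 1 and the new
    \<open>b\<close> index 0, where the two numberings begin.\<close>
  define f' where "f' = (\<lambda>i. if i = 1 then a else f (i - 1))"
  define g' where "g' = (\<lambda>j. if j = 0 then b else g (j - 1))"
  have f': "f' i = a \<and> i = 1 \<or> (\<exists>i'. i = Suc i' \<and> i' \<in> {1..r} \<and> f' i = f i')"
    if "i \<in> {1..Suc r}" for i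
    using that by (cases i) (auto simp: f'_def)
  have g': "g' j = b \<and> j = 0 \<or> (\<exists>j'. j = Suc j' \<and> j' \<le> r \<and> g' j = g j')"
    if "j \<le> Suc r" for j
    using that by (cases j) (auto simp: g'_def)
  show ?thesis
    unfolding ladder_def
  proof (intro exI[of _ f'] exI[of _ g'] conjI ballI allI impI)
    fix i assume "i \<in> {1..Suc r}"
    from f'[OF this] show "f' i \<in> S"
      by (elim disjE conjE exE) (use fg(1)[THEN subsetD[OF assms(2)]] assms(2,4) in auto)
  next
    fix j assume "j \<le> Suc r"
    from g'[OF this] show "g' j \<in> Y"
      by (elim disjE conjE exE) (use fg(2)[THEN subsetD[OF assms(3)]] assms(5) in auto)
  next
    fix i j assume "i \<in> {1..Suc r}" "j \<le> Suc r"
    from f'[OF this(1)] g'[OF this(2)] show "R (f' i) (g' j) \<longleftrightarrow> i \<le> j"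
      by (elim disjE conjE exE) (use fg(1,3) assms(4,6) fg(2)[THEN assms(7)] in auto)
  qed
qed

text \<open>
  Pick a leaf \<open>b\<close>. Half of the height survives on the nodes \<open>a\<close> on whose relation to \<open>b\<close> all
  agree; the root of what is left, together with \<open>b\<close>, extends at one of its two ends a ladder
  found in a child of that root.
\<close>

lemma ladder_of_splitting_tree:
  "splitting_tree R S (2 ^ Suc r - 2) Y \<Longrightarrow> ladder R S Y r"
proof (induction r arbitrary: S Y)
  case 0
  then obtain z where "z \<in> Y" by auto
  then show ?case unfolding ladder_def by (intro exI[of _ "\<lambda>_. z"] exI) auto
next
  case (Suc r)
  \<comment> \<open>The heights obey h(r+1) = 2 (h(r) + 1): the colouring halves the height, and the
    root \<open>a\<close> uses up one more level.\<close>
  define h :: nat where "h = 2 ^ Suc r - 2"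
  have "(2::nat) ^ r \<ge> 1" by simp
  then have h: "2 ^ Suc (Suc r) - 2 = Suc h + Suc h"
    unfolding h_def power_Suc by linarith
  from Suc.prems obtain b where b: "b \<in> Y" using splitting_tree_nonempty by blast
  have "{a \<in> S. R a b} \<union> {a \<in> S. \<not> R a b} = S" by auto
  with Suc.prems have "splitting_tree R ({a \<in> S. R a b} \<union> {a \<in> S. \<not> R a b}) (Suc h + Suc h) Y"
    by (simp only: h)
  then have "splitting_tree R {a \<in> S. R a b} (Suc h) Y \<or> splitting_tree R {a \<in> S. \<not> R a b} (Suc h) Y"
    by (rule splitting_tree_colour)
  then show ?case
  proof
    assume "splitting_tree R {a \<in> S. R a b} (Suc h) Y"
    \<comment> \<open>All remaining labels are related to \<open>b\<close>, so \<open>b\<close> must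
      come last; the shorter ladder is sought among the points unrelated to the root.\<close>
    then obtain a where a: "a \<in> {a \<in> S. R a b}"
        "splitting_tree R {a \<in> S. R a b} h {z \<in> Y. \<not> R a z}"
      by auto
    from Suc.IH[OF a(2)[unfolded h_def]] show ?thesis
      by (rule ladder_append[where a = a and b = b]) (use a b in auto)
  next
    assume "splitting_tree R {a \<in> S. \<not> R a b} (Suc h) Y"
    then obtain a where a: "a \<in> {a \<in> S. \<not> R a b}"
        "splitting_tree R {a \<in> S. \<not> R a b} h {z \<in> Y. R a z}"
      by auto
    from Suc.IH[OF a(2)[unfolded h_def]] show ?thesis
      by (rule ladder_prepend[where a = a and b = b]) (use a b in auto)
  qed
qed

text \<open>Without its \<open>b 0\<close>, a ladder of length \<open>k\<close> is exactly a
  configuration that stability forbids.\<close>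

lemma k_stable_no_splitting_tree:
  assumes "k_stable G k A"
  shows "\<not> splitting_tree (\<lambda>a b. a \<otimes>\<^bsub>G\<^esub> b \<in> A) (carrier G) (2 ^ Suc k - 2) (carrier G)"
proof
  assume "splitting_tree (\<lambda>a b. a \<otimes>\<^bsub>G\<^esub> b \<in> A) (carrier G) (2 ^ Suc k - 2) (carrier G)"
  then have "ladder (\<lambda>a b. a \<otimes>\<^bsub>G\<^esub> b \<in> A) (carrier G) (carrier G) k"
    by (rule ladder_of_splitting_tree)
  then obtain a b where "\<forall>i\<in>{1..k}. a i \<in> carrier G" "\<forall>j\<le>k. b j \<in> carrier G"
      "\<forall>i\<in>{1..k}. \<forall>j\<le>k. a i \<otimes>\<^bsub>G\<^esub> b j \<in> A \<longleftrightarrow> i \<le> j"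
    unfolding ladder_def by blast
  then have "(\<forall>i\<in>{1..k}. a i \<in> carrier G \<and> b i \<in> carrier G) \<and>
          (\<forall>i\<in>{1..k}. \<forall>j\<in>{1..k}. a i \<otimes>\<^bsub>G\<^esub> b j \<in> A \<longleftrightarrow> i \<le> j)"
    by simp
  with assms show False unfolding k_stable_def by blast
qed

section \<open>Homogeneous sets\<close>

text \<open>In stable graph regularity such sets are called good.\<close>

definition homogeneous :: "('a \<Rightarrow> 'b \<Rightarrow> bool) \<Rightarrow> 'a set \<Rightarrow> real \<Rightarrow> 'b set \<Rightarrow> bool" where
  "homogeneous R S \<delta> Y \<longleftrightarrow>
     (\<forall>a\<in>S. real (card {b \<in> Y. R a b}) \<le> \<delta> * real (card Y) \<or>
        real (card {b \<in> Y. \<not> R a b}) \<le> \<delta> * real (card Y))"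

text \<open>
  The homogeneity \<open>r * \<eta>\<close> asked for is proportional to the density \<open>\<eta>\<close> reached so far. A split
  therefore replaces \<open>\<eta>\<close> by \<open>r * \<eta>\<^sup>2\<close>, and a bounded number of splits costs only a power of \<open>r\<close>.
\<close>

lemma homogeneous_subset_of_density:
  fixes r \<eta> :: real
  assumes "\<not> splitting_tree R S n Y" "0 < r" "r \<le> 1" "0 < \<eta>" "\<eta> \<le> 1"
    and "finite Y" "M > 0" "\<eta> * M \<le> card Y"
  shows "\<exists>Z \<theta>. Z \<subseteq> Y \<and> (r * \<eta>) ^ 2 ^ n \<le> \<theta> \<and> \<theta> \<le> 1 \<and> \<theta> * M \<le> card Z \<and>
           homogeneous R S (r * \<theta>) Z"
  using assms
proof (induction n arbitrary: Y \<eta>)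
  case 0
  \<comment> \<open>Having no tree of height 0 means that \<open>Y\<close> is empty, against its
    positive density.\<close>
  then have "\<eta> * M > 0" by simp
  with 0 show ?case by simp
next
  case (Suc n)
  show ?case
  proof (cases "homogeneous R S (r * \<eta>) Y")
    case True
    have p: "0 < r * \<eta>" "r * \<eta> \<le> \<eta>" "r * \<eta> \<le> 1"
      using Suc.prems by (auto simp: mult_le_one mult_le_cancel_right1)
    then have "(r * \<eta>) ^ 2 ^ Suc n \<le> (r * \<eta>) ^ 1"
      by (intro power_decreasing) auto
    with p have "(r * \<eta>) ^ 2 ^ Suc n \<le> \<eta>" by simp
    with True Suc.prems show ?thesis by blast
  next
    case False
    then obtain a where a: "a \<in> S" "r * \<eta> * card Y < card {b \<in> Y. R a b}"
        "r * \<eta> * card Y < card {b \<in> Y. \<not> R a b}"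
      unfolding homogeneous_def by force
    \<comment> \<open>Each half has more than the fraction \<open>r * \<eta>\<close> of a set of
      density \<open>\<eta>\<close>.\<close>
    define \<xi> where "\<xi> = r * \<eta> * \<eta>"
    have "r * \<eta> \<le> 1" using Suc.prems by (simp add: mult_le_one)
    then have \<xi>: "0 < \<xi>" "\<xi> \<le> 1" unfolding \<xi>_def using Suc.prems by (auto simp: mult_le_one)
    have "\<xi> * M \<le> r * \<eta> * card Y"
      unfolding \<xi>_def using mult_left_mono[OF Suc.prems(8), of "r * \<eta>"] Suc.prems
      by (simp add: mult.assoc)
    \<comment> \<open>If both halves had trees of height \<open>n\<close>, then \<open>a\<close>
      would join them to one of height \<open>Suc n\<close>.\<close>
    obtain Z where Z: "Z \<subseteq> Y" "\<not> splitting_tree R S n Z" "\<xi> * M \<le> card Z"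
    proof (cases "splitting_tree R S n {b \<in> Y. R a b}")
      case True
      with a(1) Suc.prems(1) have "\<not> splitting_tree R S n {b \<in> Y. \<not> R a b}" by auto
      with that[of "{b \<in> Y. \<not> R a b}"] a(3) \<open>\<xi> * M \<le> r * \<eta> * card Y\<close> show ?thesis by auto
    next
      case False
      with that[of "{b \<in> Y. R a b}"] a(2) \<open>\<xi> * M \<le> r * \<eta> * card Y\<close> show ?thesis by auto
    qed
    have "finite Z" using Z(1) Suc.prems(6) finite_subset by blast
    from Suc.IH[OF Z(2) Suc.prems(2,3) \<xi> this Suc.prems(7) Z(3)]
    obtain W \<theta> where W: "W \<subseteq> Z" "(r * \<xi>) ^ 2 ^ n \<le> \<theta>" "\<theta> \<le> 1" "\<theta> * M \<le> card W"
      "homogeneous R S (r * \<theta>) W"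
      by blast
    have "r * \<xi> = (r * \<eta>) ^ 2" by (simp add: \<xi>_def power2_eq_square mult_ac)
    then have "(r * \<xi>) ^ 2 ^ n = (r * \<eta>) ^ 2 ^ Suc n" by (simp flip: power_mult)
    with W Z(1) show ?thesis by (metis subset_trans)
  qed
qed

lemma homogeneous_subset:
  fixes r :: real
  assumes "\<not> splitting_tree R S n X" "0 < r" "r \<le> 1" "finite X" "X \<noteq> {}"
  obtains Y \<eta> where "Y \<subseteq> X" "Y \<noteq> {}" "r ^ 2 ^ n \<le> \<eta>" "0 < \<eta>" "\<eta> \<le> 1" "\<eta> * card X \<le> card Y"
    "homogeneous R S (r * \<eta>) Y"
proof -
  have M: "0 < real (card X)" using assms by (simp add: card_gt_0_iff)
  from homogeneous_subset_of_density[OF assms(1-3) _ _ assms(4) M, of 1]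
  obtain Y \<eta> where Y: "Y \<subseteq> X" "r ^ 2 ^ n \<le> \<eta>" "\<eta> \<le> 1" "\<eta> * card X \<le> card Y"
    "homogeneous R S (r * \<eta>) Y"
    by auto
  have "0 < r ^ 2 ^ n" using assms(2) by simp
  with Y(2) have "0 < \<eta>" by linarith
  with M have "0 < \<eta> * card X" by simp
  with Y(4) have "Y \<noteq> {}" by auto
  from that[OF Y(1) this Y(2) \<open>0 < \<eta>\<close> Y(3-5)] show thesis .
qed

section \<open>Counting\<close>

text \<open>The Bonferroni inequality, doubled, with the number of pairs bounded by half the square
  of \<open>card I\<close>.\<close>

lemma card_UN_almost_disjoint:
  fixes s t :: real
  assumes "finite I" "\<And>i. i \<in> I \<Longrightarrow> finite (B i)" "\<And>i. i \<in> I \<Longrightarrow> s \<le> card (B i)" "0 \<le> t"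
    and "\<And>i j. i \<in> I \<Longrightarrow> j \<in> I \<Longrightarrow> i \<noteq> j \<Longrightarrow> card (B i \<inter> B j) \<le> t"
  shows "2 * real (card I) * s \<le> 2 * real (card (\<Union>i\<in>I. B i)) + (real (card I))\<^sup>2 * t"
  using assms
proof (induction I rule: finite_induct)
  case empty
  then show ?case by simp
next
  case (insert x I)
  let ?U = "\<Union>i\<in>I. B i"
  have fin: "finite ?U" "finite (B x)" using insert by auto
  have "card (B x \<inter> ?U) \<le> (\<Sum>i\<in>I. card (B x \<inter> B i))"
    unfolding Int_UN_distrib using insert.hyps(1) by (rule card_UN_le)
  then have "real (card (B x \<inter> ?U)) \<le> (\<Sum>i\<in>I. real (card (B x \<inter> B i)))"
    by (metis of_nat_le_iff of_nat_sum)
  also have "\<dots> \<le> card I * t"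
    using insert by (intro sum_bounded_above) auto
  finally have 1: "card (B x \<inter> ?U) \<le> card I * t" .
  have "card (B x \<union> ?U) + card (B x \<inter> ?U) = card (B x) + card ?U"
    using card_Un_Int[OF fin(2,1)] by simp
  then have 2: "real (card (B x \<union> ?U)) + card (B x \<inter> ?U) = card (B x) + card ?U"
    by linarith
  have 3: "2 * real (card I) * s \<le> 2 * real (card ?U) + (real (card I))\<^sup>2 * t"
    using insert by auto
  have 4: "s \<le> card (B x)" using insert by auto
  have "2 * (real (card I) + 1) * s = 2 * real (card I) * s + 2 * s" by (simp add: algebra_simps)
  moreover have "(real (card I) + 1)\<^sup>2 * t = (real (card I))\<^sup>2 * t + 2 * (card I * t) + t"
    by (simp add: power2_eq_square algebra_simps)
  ultimately have "2 * (real (card I) + 1) * s \<le> 2 * real (card (B x \<union> ?U)) + (real (card I) + 1)\<^sup>2 * t"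
    using 1 2 3 4 insert.prems(3) by linarith
  then show ?case using insert.hyps by (simp add: add.commute)
qed

text \<open>The overlap loss is quadratic, so a large family is first cut down to \<open>m\<close>
  sets with \<open>2 * L < m\<close> and \<open>m \<le> 3 * L\<close>. They lose at most 3/8 of
  their total size, and the remaining 5/8 still exceeds \<open>L * s\<close>.\<close>

lemma card_almost_disjoint_family_le:
  fixes L \<delta> s :: real
  assumes "finite I" "\<And>i. i \<in> I \<Longrightarrow> B i \<subseteq> U" "finite U" "\<And>i. i \<in> I \<Longrightarrow> s = card (B i)" "0 < s"
    and "\<And>i j. i \<in> I \<Longrightarrow> j \<in> I \<Longrightarrow> i \<noteq> j \<Longrightarrow> card (B i \<inter> B j) \<le> 2 * \<delta> * s"
    and "card U \<le> L * s" "1 \<le> L" "0 \<le> \<delta>" "\<delta> * L \<le> 1 / 8"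
  shows "card I \<le> 2 * L"
proof (rule ccontr)
  assume "\<not> card I \<le> 2 * L"
  \<comment> \<open>The least integer above \<open>2 * L\<close>; it is at most \<open>3 * L\<close>
    because \<open>L\<close> is at least 1.\<close>
  define m where "m = nat \<lfloor>2 * L\<rfloor> + 1"
  have m: "2 * L < m" "m \<le> 3 * L"
    unfolding m_def using assms(8) by linarith+
  have "m \<le> card I" unfolding m_def using \<open>\<not> card I \<le> 2 * L\<close> assms(8) by linarith
  then obtain J where J: "J \<subseteq> I" "card J = m" "finite J"
    using obtain_subset_with_card_n by metis
  have "2 * real (card J) * s \<le> 2 * real (card (\<Union>i\<in>J. B i)) + (real (card J))\<^sup>2 * (2 * \<delta> * s)"
  proof (rule card_UN_almost_disjoint)
    show "finite (B i)" if "i \<in> J" for i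
      using that J assms(2,3) finite_subset by blast
    show "s \<le> card (B i)" if "i \<in> J" for i using that J assms(4)[of i] by auto
    show "card (B i \<inter> B j) \<le> 2 * \<delta> * s" if "i \<in> J" "j \<in> J" "i \<noteq> j" for i j
      using that J(1) by (intro assms(6)) auto
  qed (use J assms(5,9) in auto)
  moreover have "card (\<Union>i\<in>J. B i) \<le> card U"
    using J assms by (intro card_mono) auto
  ultimately have "2 * real m * s \<le> 2 * (L * s) + (real m)\<^sup>2 * (2 * \<delta> * s)"
    using assms(7) J(2) by simp
  then have "(real m - m * (m * \<delta>)) * s \<le> L * s"
    by (simp add: algebra_simps power2_eq_square)
  then have "real m - m * (m * \<delta>) \<le> L" using assms(5) by simp
  then have le: "m * (1 - m * \<delta>) \<le> L" by (simp add: right_diff_distrib)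
  have "m * \<delta> \<le> 3 * L * \<delta>" using m(2) assms(9) by (intro mult_right_mono) auto
  also have "\<dots> = 3 * (\<delta> * L)" by simp
  finally have "5 / 8 \<le> 1 - m * \<delta>" using assms(10) by linarith
  then have "m * (5 / 8) \<le> m * (1 - m * \<delta>)" by (intro mult_left_mono) auto
  with le m(1) assms(8) show False by linarith
qed

text \<open>Double counting of the pairs in \<open>E\<close>.\<close>

lemma exists_fibre_card_le_average:
  fixes \<delta> :: real
  assumes "finite U" "finite Y" "Y \<noteq> {}"
    and "\<And>g. g \<in> U \<Longrightarrow> card {y \<in> Y. E g y} \<le> \<delta> * card Y"
  obtains y where "y \<in> Y" "card {g \<in> U. E g y} \<le> \<delta> * card U"
proof (rule ccontr)
  assume no: "\<not> thesis"
  note fibre = that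
  have lt: "\<delta> * card U < card {g \<in> U. E g y}" if "y \<in> Y" for y
    using no fibre[OF that] by (meson not_le)
  have "card Y * (\<delta> * card U) = (\<Sum>y\<in>Y. \<delta> * card U)" by simp
  also have "\<dots> < (\<Sum>y\<in>Y. real (card {g \<in> U. E g y}))"
    using assms lt by (intro sum_strict_mono) auto
  also have "\<dots> = (\<Sum>y\<in>Y. \<Sum>g\<in>U. if E g y then 1 else 0)"
    using assms by (simp add: sum.If_cases Int_def)
  also have "\<dots> = (\<Sum>g\<in>U. \<Sum>y\<in>Y. if E g y then 1 else 0)" by (rule sum.swap)
  also have "\<dots> = (\<Sum>g\<in>U. real (card {y \<in> Y. E g y}))"
    using assms by (simp add: sum.If_cases Int_def)
  also have "\<dots> \<le> card U * (\<delta> * card Y)" using assms by (intro sum_bounded_above) auto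
  finally show False by (simp add: mult_ac)
qed

text \<open>Chooses coset representatives, with cosets encoded as values of
  \<open>f\<close>.\<close>

lemma exists_transversal:
  obtains Q where "Q \<subseteq> X" "inj_on f Q" "f ` Q = f ` X"
  using subset_image_inj[of "f ` X" f X] by (metis order_refl)

section \<open>The stabiliser of a homogeneous set\<close>

context group
begin

lemma inv_mult_cancel:
  assumes "x \<in> carrier G" "y \<in> carrier G"
  shows "inv x \<otimes> (x \<otimes> y) = y" "x \<otimes> (inv x \<otimes> y) = y"
  using assms by (simp_all flip: m_assoc)

lemmas cancel_simps = m_assoc inv_mult_group inv_mult_cancel

definition right_stabiliser :: "'a set \<Rightarrow> 'a set" where
  "right_stabiliser P = {x \<in> carrier G. \<forall>g\<in>carrier G. g \<otimes> x \<in> P \<longleftrightarrow> g \<in> P}"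

lemma right_stabiliserD:
  "x \<in> right_stabiliser P \<Longrightarrow> g \<in> carrier G \<Longrightarrow> g \<otimes> x \<in> P \<longleftrightarrow> g \<in> P"
  by (simp add: right_stabiliser_def)

lemma right_stabiliserI:
  "x \<in> carrier G \<Longrightarrow> (\<And>g. g \<in> carrier G \<Longrightarrow> g \<otimes> x \<in> P \<longleftrightarrow> g \<in> P) \<Longrightarrow> x \<in> right_stabiliser P"
  by (simp add: right_stabiliser_def)

lemma subgroup_right_stabiliser: "subgroup (right_stabiliser P) G"
proof (rule subgroup.intro)
  fix x y assume "x \<in> right_stabiliser P" "y \<in> right_stabiliser P"
  then show "x \<otimes> y \<in> right_stabiliser P"
    by (simp add: right_stabiliser_def flip: m_assoc)
next
  fix x assume x: "x \<in> right_stabiliser P"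
  have "g \<otimes> inv x \<in> P \<longleftrightarrow> g \<otimes> inv x \<otimes> x \<in> P" if "g \<in> carrier G" for g
    using x that by (simp add: right_stabiliser_def)
  with x show "inv x \<in> right_stabiliser P"
    by (simp add: right_stabiliser_def m_assoc)
qed (auto simp: right_stabiliser_def)

lemma subgroup_conjugate:
  assumes "subgroup H G" "y \<in> carrier G"
  shows "subgroup ((\<lambda>h. inv y \<otimes> h \<otimes> y) ` H) G"
proof (rule subgroup.intro)
  interpret H: subgroup H G by fact
  show "(\<lambda>h. inv y \<otimes> h \<otimes> y) ` H \<subseteq> carrier G" using assms by auto
  show "\<one> \<in> (\<lambda>h. inv y \<otimes> h \<otimes> y) ` H"
    using assms by (auto intro!: image_eqI[of _ _ \<one>])
  fix u assume "u \<in> (\<lambda>h. inv y \<otimes> h \<otimes> y) ` H"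
  then obtain h where h: "h \<in> H" "u = inv y \<otimes> h \<otimes> y" by auto
  then show "inv u \<in> (\<lambda>h. inv y \<otimes> h \<otimes> y) ` H"
    using assms by (auto intro!: image_eqI[of _ _ "inv h"] simp: cancel_simps)
  fix v assume "v \<in> (\<lambda>h. inv y \<otimes> h \<otimes> y) ` H"
  then obtain k where k: "k \<in> H" "v = inv y \<otimes> k \<otimes> y" by auto
  show "u \<otimes> v \<in> (\<lambda>h. inv y \<otimes> h \<otimes> y) ` H"
    using assms h k by (auto intro!: image_eqI[of _ _ "h \<otimes> k"] simp: cancel_simps)
qed

text \<open>\<open>L\<close> combines the tripling constant with the density of \<open>Y\<close>; it
  will be \<open>c / \<eta>\<close>.\<close>

lemma coset_approximation_of_homogeneous:
  fixes \<epsilon> L :: real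
  assumes A: "A \<subseteq> carrier G" "finite A" and Y: "Y \<subseteq> A" "Y \<noteq> {}"
    and hom: "homogeneous (\<lambda>a b. a \<otimes> b \<in> A) (carrier G) (\<epsilon> / (4 * L)) Y"
    and L: "1 \<le> L" "card (A <#> set_inv A <#> A) \<le> L * card Y"
    and \<epsilon>: "0 < \<epsilon>" "\<epsilon> \<le> 1 / 2"
  obtains H C D where "subgroup H G" "H \<subseteq> set_inv A <#> A" "C \<subseteq> A" "A \<subseteq> C <#> H"
    "card C \<le> 2 * L" "D \<subseteq> C" "card (sym_diff A (D <#> H)) < \<epsilon> * card H"
proof -
  \<comment> \<open>Two needs fix this value: \<open>\<delta> * L \<le> 1 / 8\<close> for counting
    cosets, and \<open>\<delta> * (2 * L) = \<epsilon> / 2\<close> for the final error on at most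
    \<open>2 * L\<close> cosets.\<close>
  define \<delta> where "\<delta> = \<epsilon> / (4 * L)"
  define s where "s = real (card Y)"
  define U where "U = A <#> set_inv A"
  define P where "P = {g \<in> carrier G. card {y \<in> Y. g \<otimes> y \<notin> A} \<le> \<delta> * s}"
  \<comment> \<open>Encodes the left coset \<open>h <# H\<close>: equal values of \<open>F\<close>
    mean equal cosets.\<close>
  define F where "F = (\<lambda>h. {g \<in> carrier G. g \<otimes> h \<in> P})"
  define B where "B = (\<lambda>h. (\<lambda>y. h \<otimes> y) ` Y)"
  define H where "H = right_stabiliser P"
  have finY: "finite Y" and Yc: "Y \<subseteq> carrier G" using A Y finite_subset by blast+
  have s: "0 < s" unfolding s_def using finY Y by (simp add: card_gt_0_iff)
  have \<delta>: "0 < \<delta>" "\<delta> * L \<le> 1 / 8" "\<delta> * (2 * L) = \<epsilon> / 2"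
    unfolding \<delta>_def using \<epsilon> L by (auto simp: field_simps)
  have "\<delta> * 1 \<le> \<delta> * L" using \<delta> L by (intro mult_left_mono) auto
  with \<delta>(2) have \<delta>1: "\<delta> < 1" by linarith
  have U_iff: "g \<in> U \<longleftrightarrow> (\<exists>a\<in>A. \<exists>b\<in>A. g = a \<otimes> inv b)" for g
    unfolding U_def set_mult_def SET_INV_def by auto
  have "U = (\<lambda>(a, b). a \<otimes> inv b) ` (A \<times> A)" unfolding set_eq_iff U_iff by auto
  then have finU: "finite U" using A by simp
  have Uc: "U \<subseteq> carrier G" using A(1) unfolding U_iff subset_iff by auto
  have Pc: "P \<subseteq> carrier G" by (auto simp: P_def)
  \<comment> \<open>Homogeneity turns failing to be almost inside \<open>A\<close> into being almost
    outside it.\<close>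
  have notP: "card {y \<in> Y. g \<otimes> y \<in> A} \<le> \<delta> * s" if "g \<in> carrier G" "g \<notin> P" for g
    using hom that unfolding homogeneous_def P_def \<delta>_def s_def by auto
  have inP: "card {y \<in> Y. g \<otimes> y \<notin> A} \<le> \<delta> * s" if "g \<in> P" for g
    using that by (simp add: P_def)
  \<comment> \<open>Since \<open>\<delta> < 1\<close>, the translate of \<open>Y\<close> by
    \<open>g\<close> meets \<open>A\<close>. This makes \<open>P\<close>, and later
    \<open>H\<close>, finite.\<close>
  have PU: "P \<subseteq> U"
  proof
    fix g assume g: "g \<in> P"
    have "\<exists>y\<in>Y. g \<otimes> y \<in> A"
    proof (rule ccontr)
      assume "\<not> ?thesis"
      then have "{y \<in> Y. g \<otimes> y \<notin> A} = Y" by auto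
      with inP[OF g] have "1 * s \<le> \<delta> * s" by (simp add: s_def)
      with s \<delta>1 show False by simp
    qed
    then obtain y where y: "y \<in> Y" "g \<otimes> y \<in> A" by auto
    moreover have "g = (g \<otimes> y) \<otimes> inv y" using y g Pc Yc by (simp add: m_assoc subset_iff)
    ultimately show "g \<in> U" using Y unfolding U_iff by blast
  qed
  have oneP: "\<one> \<in> P"
  proof -
    have "\<one> \<otimes> y \<in> A" if "y \<in> Y" for y
      using that Y(1) Yc by (simp add: subset_iff)
    then have "{y \<in> Y. \<one> \<otimes> y \<notin> A} = {}" by blast
    then have "card {y \<in> Y. \<one> \<otimes> y \<notin> A} = 0" by (simp only: card.empty)
    then show ?thesis using s \<delta>(1) unfolding P_def by simp
  qed

  \<comment> \<open>Translation by \<open>g\<close> puts \<open>B h\<close> almost inside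
    \<open>A\<close> and \<open>B h'\<close> almost outside, so common points come only from the two
    exceptional sets.\<close>
  have sep: "card (B h \<inter> B h') \<le> 2 * \<delta> * s"
    if "g \<in> carrier G" "h \<in> carrier G" "h' \<in> carrier G" "g \<otimes> h \<in> P" "g \<otimes> h' \<notin> P" for g h h'
  proof -
    let ?X = "{y \<in> Y. (g \<otimes> h) \<otimes> y \<notin> A}" and ?X' = "{y \<in> Y. (g \<otimes> h') \<otimes> y \<in> A}"
    have "B h \<inter> B h' \<subseteq> (\<lambda>y. h \<otimes> y) ` ?X \<union> (\<lambda>y. h' \<otimes> y) ` ?X'"
    proof
      fix z assume "z \<in> B h \<inter> B h'"
      then obtain y y' where y: "y \<in> Y" "z = h \<otimes> y" "y' \<in> Y" "z = h' \<otimes> y'"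
        by (auto simp: B_def)
      have "(g \<otimes> h) \<otimes> y = g \<otimes> z" "(g \<otimes> h') \<otimes> y' = g \<otimes> z"
        using y that Yc by (auto simp: m_assoc)
      with y show "z \<in> (\<lambda>y. h \<otimes> y) ` ?X \<union> (\<lambda>y. h' \<otimes> y) ` ?X'"
        by (metis (mono_tags, lifting) UnI1 UnI2 image_eqI mem_Collect_eq)
    qed
    then have "card (B h \<inter> B h') \<le> card ((\<lambda>y. h \<otimes> y) ` ?X \<union> (\<lambda>y. h' \<otimes> y) ` ?X')"
      using finY by (intro card_mono) auto
    also have "\<dots> \<le> card ((\<lambda>y. h \<otimes> y) ` ?X) + card ((\<lambda>y. h' \<otimes> y) ` ?X')" by (rule card_Un_le)
    also have "\<dots> \<le> card ?X + card ?X'" using finY by (intro add_mono card_image_le) auto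
    finally have "card (B h \<inter> B h') \<le> card ?X + card ?X'" .
    moreover have "card ?X \<le> \<delta> * s" using inP that by blast
    moreover have "card ?X' \<le> \<delta> * s" using notP that by blast
    ultimately show ?thesis by linarith
  qed
  have sepF: "card (B h \<inter> B h') \<le> 2 * \<delta> * s"
    if h: "h \<in> carrier G" "h' \<in> carrier G" "F h \<noteq> F h'" for h h'
  proof -
    from h(3) obtain g where g: "g \<in> carrier G" "g \<otimes> h \<in> P \<longleftrightarrow> g \<otimes> h' \<notin> P"
      unfolding F_def by blast
    show ?thesis
      using sep[of g h h'] sep[of g h' h] g h by (cases "g \<otimes> h \<in> P") (auto simp: Int_commute)
  qed
  have bound: "card Q \<le> 2 * L" if Q: "Q \<subseteq> U" "inj_on F Q" for Q
  proof (rule card_almost_disjoint_family_le[where B = B and U = "U <#> A" and s = s and \<delta> = \<delta>])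
    have "U <#> A = (\<lambda>(u, a). u \<otimes> a) ` (U \<times> A)" by (auto simp: set_mult_def)
    then show "finite (U <#> A)" using finU A by simp
    show "finite Q" using Q finU finite_subset by blast
    show "B i \<subseteq> U <#> A" if "i \<in> Q" for i
      using that Q Y by (auto simp: B_def set_mult_def)
    show "s = card (B i)" if "i \<in> Q" for i
    proof -
      have "inj_on (\<lambda>y. i \<otimes> y) Y"
        using that Q(1) Uc Yc by (intro inj_onI) (metis inv_mult_cancel(1) subsetD)
      then show ?thesis by (simp add: B_def s_def card_image)
    qed
    show "card (B i \<inter> B j) \<le> 2 * \<delta> * s" if "i \<in> Q" "j \<in> Q" "i \<noteq> j" for i j
      using that Q Uc by (intro sepF) (auto dest: inj_onD)
    show "card (U <#> A) \<le> L * s" using L by (simp add: U_def s_def)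
  qed (use s \<delta> L in auto)

  have subH: "subgroup H G" unfolding H_def by (rule subgroup_right_stabiliser)
  interpret H: subgroup H G by fact
  have Hc: "H \<subseteq> carrier G" by (rule H.subset)
  have PH: "g \<otimes> h \<in> P \<longleftrightarrow> g \<in> P" if "g \<in> carrier G" "h \<in> H" for g h
    using that unfolding H_def by (intro right_stabiliserD)
  have HP: "H \<subseteq> P"
  proof
    fix h assume h: "h \<in> H"
    with PH[OF one_closed h] oneP Hc show "h \<in> P" by auto
  qed
  then have finH: "finite H" using PU finU by (meson finite_subset)
  have "H \<noteq> {}" using H.one_closed by blast
  then have cardH: "0 < real (card H)" using finH by (simp add: card_gt_0_iff)
  have FH: "inv h \<otimes> h' \<in> H" if h: "h \<in> carrier G" "h' \<in> carrier G" "F h = F h'" for h h'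
  proof -
    have "g \<otimes> (inv h \<otimes> h') \<in> P \<longleftrightarrow> g \<in> P" if g: "g \<in> carrier G" for g
    proof -
      \<comment> \<open>Equality of the two values of \<open>F\<close> is tested at
        \<open>g \<otimes> inv h\<close>.\<close>
      have "g \<otimes> inv h \<in> F h' \<longleftrightarrow> g \<otimes> inv h \<in> F h" using h by simp
      then show ?thesis using g h by (simp add: F_def m_assoc)
    qed
    with h show ?thesis unfolding H_def by (intro right_stabiliserI) auto
  qed
  have cardU: "card U \<le> 2 * L * card H"
  proof -
    obtain Q where Q: "Q \<subseteq> U" "inj_on F Q" "F ` Q = F ` U" by (rule exists_transversal)
    have finQ: "finite Q" using Q finU finite_subset by blast
    have "U \<subseteq> (\<lambda>(q, h). q \<otimes> h) ` (Q \<times> H)"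
    proof
      fix u assume u: "u \<in> U"
      with Q obtain q where q: "q \<in> Q" "F q = F u" by (metis imageE imageI)
      have "inv q \<otimes> u \<in> H" "q \<otimes> (inv q \<otimes> u) = u"
        using q u Q(1) Uc by (auto intro!: FH simp: inv_mult_cancel subset_iff)
      with q show "u \<in> (\<lambda>(q, h). q \<otimes> h) ` (Q \<times> H)" by force
    qed
    then have "card U \<le> card ((\<lambda>(q, h). q \<otimes> h) ` (Q \<times> H))"
      using finQ finH by (intro card_mono) auto
    also have "\<dots> \<le> card (Q \<times> H)" using finQ finH by (intro card_image_le) auto
    also have "\<dots> = card Q * card H" by (rule card_cartesian_product)
    finally have "real (card U) \<le> real (card Q) * real (card H)" by (metis of_nat_le_iff of_nat_mult)
    also have "\<dots> \<le> 2 * L * card H" using bound[OF Q(1,2)] by (intro mult_right_mono) auto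
    finally show ?thesis .
  qed

  obtain y where y: "y \<in> Y" "card {g \<in> U. (g \<otimes> y \<in> A) \<noteq> (g \<in> P)} \<le> \<delta> * card U"
  proof (rule exists_fibre_card_le_average[OF finU finY Y(2)])
    fix g assume g: "g \<in> U"
    show "card {y \<in> Y. (g \<otimes> y \<in> A) \<noteq> (g \<in> P)} \<le> \<delta> * card Y"
      using inP[of g] notP[of g] g Uc by (cases "g \<in> P") (auto simp: s_def)
  qed
  have yc: "y \<in> carrier G" and yA: "y \<in> A" using y Y Yc by auto
  define Py where "Py = (\<lambda>p. p \<otimes> y) ` P"
  have AU: "a \<otimes> inv y \<in> U" if "a \<in> A" for a using that yA U_iff by blast
  \<comment> \<open>Translated back by \<open>inv y\<close>, both \<open>A\<close> and
    \<open>Py\<close> lie in \<open>U\<close>, so averaging over \<open>U\<close> alone sees the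
    whole difference.\<close>
  have "sym_diff A Py \<subseteq> (\<lambda>g. g \<otimes> y) ` {g \<in> U. (g \<otimes> y \<in> A) \<noteq> (g \<in> P)}"
  proof
    fix z assume z: "z \<in> sym_diff A Py"
    show "z \<in> (\<lambda>g. g \<otimes> y) ` {g \<in> U. (g \<otimes> y \<in> A) \<noteq> (g \<in> P)}"
    proof (cases "z \<in> A")
      case True
      with A have e: "z = (z \<otimes> inv y) \<otimes> y" using yc by (simp add: m_assoc subset_iff)
      with z True have "z \<otimes> inv y \<notin> P" by (auto simp: Py_def)
      with True AU[OF True] e show ?thesis by (intro image_eqI[of _ _ "z \<otimes> inv y"]) auto
    next
      case False
      with z PU show ?thesis by (auto simp: Py_def)
    qed
  qed
  then have "card (sym_diff A Py) \<le> card ((\<lambda>g. g \<otimes> y) ` {g \<in> U. (g \<otimes> y \<in> A) \<noteq> (g \<in> P)})"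
    using finU by (intro card_mono) auto
  also have "\<dots> \<le> card {g \<in> U. (g \<otimes> y \<in> A) \<noteq> (g \<in> P)}" using finU by (intro card_image_le) auto
  finally have "card (sym_diff A Py) \<le> \<delta> * card U" using y(2) by linarith
  also have "\<dots> \<le> \<delta> * (2 * L * card H)" using cardU \<delta> by (intro mult_left_mono) auto
  also have "\<dots> = \<epsilon> / 2 * card H" using \<delta>(3) by (simp flip: mult.assoc)
  finally have diff: "card (sym_diff A Py) \<le> \<epsilon> / 2 * card H" .
  have finPy: "finite Py" using PU finU finite_subset unfolding Py_def by blast
  \<comment> \<open>The translated coset \<open>p H y\<close> lies in \<open>Py\<close>, so its
    points outside \<open>A\<close> all belong to the small difference.\<close>
  have coset: "card {h \<in> H. p \<otimes> h \<otimes> y \<notin> A} \<le> \<epsilon> / 2 * card H" if p: "p \<in> P" for p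
  proof -
    have pc: "p \<in> carrier G" using p Pc by auto
    have "inj_on (\<lambda>h. p \<otimes> h \<otimes> y) {h \<in> H. p \<otimes> h \<otimes> y \<notin> A}"
      using pc yc Hc by (intro inj_onI) (auto simp: subset_iff)
    moreover have "(\<lambda>h. p \<otimes> h \<otimes> y) ` {h \<in> H. p \<otimes> h \<otimes> y \<notin> A} \<subseteq> sym_diff A Py"
      using PH pc p by (auto simp: Py_def)
    ultimately have "card {h \<in> H. p \<otimes> h \<otimes> y \<notin> A} \<le> card (sym_diff A Py)"
      using A finPy by (intro card_inj_on_le) auto
    with diff show ?thesis by linarith
  qed

  \<comment> \<open>Conjugation turns \<open>p H y\<close> into the left coset of \<open>H'\<close>
    that contains \<open>p \<otimes> y\<close>.\<close>
  define H' where "H' = (\<lambda>h. inv y \<otimes> h \<otimes> y) ` H"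
  have "inj_on (\<lambda>h. inv y \<otimes> h \<otimes> y) H"
    using yc Hc by (intro inj_onI) (auto simp: subset_iff)
  then have cardH': "card H' = card H" unfolding H'_def by (rule card_image)
  have H'_sub: "H' \<subseteq> set_inv A <#> A"
  proof
    fix x assume "x \<in> H'"
    then obtain h where h: "h \<in> H" "x = inv y \<otimes> h \<otimes> y" by (auto simp: H'_def)
    have hc: "h \<in> carrier G" using h Hc by auto
    \<comment> \<open>Less than half of \<open>Hy\<close> lies outside \<open>A\<close>, so \<open>Hy \<inter> A\<close> meets its translate by \<open>x\<close>.\<close>
    let ?X = "{u \<in> H. \<one> \<otimes> u \<otimes> y \<notin> A}" and ?X' = "{u \<in> H. u \<otimes> h \<otimes> y \<notin> A}"
    have inj: "inj_on (\<lambda>u. u \<otimes> h) ?X'" using hc Hc by (intro inj_onI) (auto simp: subset_iff)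
    have "(\<lambda>u. u \<otimes> h) ` ?X' \<subseteq> ?X"
    proof (rule image_subsetI)
      fix u assume "u \<in> ?X'"
      then have "u \<in> H" "u \<otimes> h \<otimes> y \<notin> A" by auto
      then show "u \<otimes> h \<in> ?X" using h(1) Hc hc by (auto simp: subset_iff)
    qed
    from card_inj_on_le[OF inj this] finH have "card ?X' \<le> card ?X" by simp
    moreover have "card ?X \<le> \<epsilon> / 2 * card H" by (rule coset[OF oneP])
    moreover have "card (?X \<union> ?X') \<le> card ?X + card ?X'" by (rule card_Un_le)
    moreover have "\<epsilon> * card H < 1 * real (card H)"
      using cardH \<epsilon> by (intro mult_strict_right_mono) auto
    ultimately have "card (?X \<union> ?X') < card H" by linarith
    then have "?X \<union> ?X' \<noteq> H" by auto
    then obtain u where u: "u \<in> H" "u \<otimes> y \<in> A" "u \<otimes> h \<otimes> y \<in> A" using Hc by auto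
    have "x = inv (u \<otimes> y) \<otimes> (u \<otimes> h \<otimes> y)"
      using h u(1) Hc hc yc by (auto simp: cancel_simps)
    with u show "x \<in> set_inv A <#> A" unfolding set_mult_def SET_INV_def by auto
  qed
  obtain C where C: "C \<subseteq> A" "inj_on (\<lambda>a. F (a \<otimes> inv y)) C"
      "(\<lambda>a. F (a \<otimes> inv y)) ` C = (\<lambda>a. F (a \<otimes> inv y)) ` A"
    by (rule exists_transversal)
  have rep: "\<exists>c\<in>C. F (c \<otimes> inv y) = F (a \<otimes> inv y) \<and> inv c \<otimes> a \<in> H'" if a: "a \<in> A" for a
  proof -
    have "F (a \<otimes> inv y) \<in> (\<lambda>a. F (a \<otimes> inv y)) ` C" unfolding C(3) using a by (rule imageI)
    then obtain c where c: "c \<in> C" "F (c \<otimes> inv y) = F (a \<otimes> inv y)" by (elim imageE) simp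
    have cc: "c \<in> carrier G" "a \<in> carrier G" using c a C A by auto
    from c FH[of "c \<otimes> inv y" "a \<otimes> inv y"] cc yc
    have "inv (c \<otimes> inv y) \<otimes> (a \<otimes> inv y) \<in> H" by simp
    moreover have "inv c \<otimes> a = inv y \<otimes> (inv (c \<otimes> inv y) \<otimes> (a \<otimes> inv y)) \<otimes> y"
      using cc yc by (simp add: cancel_simps)
    ultimately have "inv c \<otimes> a \<in> H'" unfolding H'_def by blast
    with c show ?thesis by blast
  qed
  have subH': "subgroup H' G" unfolding H'_def by (rule subgroup_conjugate[OF subH yc])
  have AC: "A \<subseteq> C <#> H'"
  proof
    fix a assume a: "a \<in> A"
    from rep[OF a] obtain c where c: "c \<in> C" "inv c \<otimes> a \<in> H'" by blast
    have "a = c \<otimes> (inv c \<otimes> a)" using c a C A by (simp add: inv_mult_cancel subset_iff)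
    with c show "a \<in> C <#> H'" unfolding set_mult_def by blast
  qed
  have cardC: "card C \<le> 2 * L"
  proof -
    have "inj_on (\<lambda>a. a \<otimes> inv y) C" "inj_on F ((\<lambda>a. a \<otimes> inv y) ` C)"
      using C(2) by (auto simp: inj_on_def)
    moreover have "(\<lambda>a. a \<otimes> inv y) ` C \<subseteq> U" using AU C by auto
    ultimately show ?thesis using bound[of "(\<lambda>a. a \<otimes> inv y) ` C"] by (simp add: card_image)
  qed
  define D where "D = {c \<in> C. c \<otimes> inv y \<in> P}"
  have "D <#> H' = Py"
  proof
    show "D <#> H' \<subseteq> Py"
    proof
      fix z assume "z \<in> D <#> H'"
      then obtain d h where d: "d \<in> D" "h \<in> H" "z = d \<otimes> (inv y \<otimes> h \<otimes> y)"
        unfolding set_mult_def H'_def by auto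
      have dc: "d \<in> carrier G" "h \<in> carrier G" using d C A Hc by (auto simp: D_def)
      have "z = (d \<otimes> inv y \<otimes> h) \<otimes> y" using d dc yc by (simp add: m_assoc)
      moreover have "d \<otimes> inv y \<otimes> h \<in> P" using d dc yc by (simp add: PH D_def)
      ultimately show "z \<in> Py" unfolding Py_def by blast
    qed
    show "Py \<subseteq> D <#> H'"
    proof
      fix z assume "z \<in> Py"
      then obtain p where p: "p \<in> P" "z = p \<otimes> y" by (auto simp: Py_def)
      have pc: "p \<in> carrier G" using p Pc by auto
      \<comment> \<open>\<open>C\<close> only represents cosets that meet \<open>A\<close>. Each
        \<open>p H y\<close> does, as it is not wholly outside \<open>A\<close>.\<close>
      have "\<epsilon> / 2 * card H < 1 * real (card H)"
        using cardH \<epsilon> by (intro mult_strict_right_mono) auto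
      with coset[OF p(1)] have "{h \<in> H. p \<otimes> h \<otimes> y \<notin> A} \<noteq> H" by auto
      then obtain h where h: "h \<in> H" "p \<otimes> h \<otimes> y \<in> A" by auto
      have hc: "h \<in> carrier G" using h Hc by auto
      from rep[OF h(2)] obtain c where c: "c \<in> C" "F (c \<otimes> inv y) = F (p \<otimes> h \<otimes> y \<otimes> inv y)"
          "inv c \<otimes> (p \<otimes> h \<otimes> y) \<in> H'"
        by blast
      have cc: "c \<in> carrier G" using c C A by auto
      have "p \<otimes> h \<otimes> y \<otimes> inv y = p \<otimes> h" using pc hc yc by (simp add: m_assoc)
      \<comment> \<open>\<open>\<one> \<in> F x\<close> says \<open>x \<in> P\<close>, so equal
        values of \<open>F\<close> carry membership in \<open>P\<close> over to
        \<open>c \<otimes> inv y\<close>.\<close>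
      moreover have "\<one> \<in> F (p \<otimes> h)" using pc hc PH[OF pc h(1)] p by (simp add: F_def)
      ultimately have "\<one> \<in> F (c \<otimes> inv y)" using c(2) by simp
      then have "c \<in> D" using cc yc c(1) by (simp add: F_def D_def)
      moreover have "inv c \<otimes> (p \<otimes> h \<otimes> y) \<otimes> (inv y \<otimes> inv h \<otimes> y) \<in> H'"
        using h by (intro subgroup.m_closed[OF subH' c(3)]) (auto simp: H'_def)
      moreover have "z = c \<otimes> (inv c \<otimes> (p \<otimes> h \<otimes> y) \<otimes> (inv y \<otimes> inv h \<otimes> y))"
        using p(2) cc pc hc yc by (simp add: cancel_simps)
      ultimately show "z \<in> D <#> H'" unfolding set_mult_def by blast
    qed
  qed
  \<comment> \<open>The spare factor 2 in the choice of \<open>\<delta>\<close> yields the strict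
    inequality.\<close>
  moreover have "\<epsilon> / 2 * card H < \<epsilon> * card H'"
    unfolding cardH' using cardH \<epsilon> by (intro mult_strict_right_mono) auto
  ultimately have "card (sym_diff A (D <#> H')) < \<epsilon> * card H'" using diff by simp
  moreover have "D \<subseteq> C" by (auto simp: D_def)
  ultimately show thesis using that[OF subH' H'_sub C(1) AC cardC] by blast
qed

text \<open>The number of cosets is at most \<open>2 * c / \<eta>\<close>, where
  \<open>\<eta>\<close> is at least \<open>\<epsilon> / (4 * c)\<close> to the power
  \<open>2 ^ n\<close>.\<close>

lemma suitable_consts_explicit:
  fixes k :: nat
  defines "n \<equiv> 2 ^ Suc k - 2"
  shows "suitable_consts G k (2 * 4 ^ 2 ^ n) (real (2 ^ n + 1))"
  unfolding suitable_consts_def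
proof (intro allI impI)
  fix c \<epsilon> :: real and A
  assume c: "1 \<le> c" and A: "A \<subseteq> carrier G" "finite A" "A \<noteq> {}" and st: "k_stable G k A"
    and trip: "real (card (A <#> set_inv A <#> A)) \<le> c * real (card A)"
    and \<epsilon>: "0 < \<epsilon>" "\<epsilon> \<le> 1 / 2"
  \<comment> \<open>Chosen so that \<open>r * \<eta>\<close> is the required
    \<open>\<epsilon> / (4 * L)\<close> for \<open>L = c / \<eta>\<close>, whatever
    \<open>\<eta>\<close> turns out to be.\<close>
  define r where "r = \<epsilon> / (4 * c)"
  have r: "0 < r" "r \<le> 1" unfolding r_def using c \<epsilon> by (auto simp: field_simps)
  have "\<not> splitting_tree (\<lambda>a b. a \<otimes> b \<in> A) (carrier G) n A"
    using k_stable_no_splitting_tree[OF st] splitting_tree_mono A(1) unfolding n_def by blast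
  from homogeneous_subset[OF this r A(2,3)] obtain Y \<eta> where Y: "Y \<subseteq> A" "Y \<noteq> {}"
    "r ^ 2 ^ n \<le> \<eta>" "0 < \<eta>" "\<eta> \<le> 1" "\<eta> * card A \<le> card Y"
    "homogeneous (\<lambda>a b. a \<otimes> b \<in> A) (carrier G) (r * \<eta>) Y"
    by blast
  define L where "L = c / \<eta>"
  have "r * \<eta> = \<epsilon> / (4 * L)" unfolding r_def L_def using Y c by (simp add: field_simps)
  note hom = Y(7)[unfolded this]
  have L: "1 \<le> L" unfolding L_def using Y c by (simp add: field_simps)
  have "c * card A = L * (\<eta> * card A)" unfolding L_def using Y by simp
  also have "\<dots> \<le> L * card Y" using Y L by (intro mult_left_mono) auto
  finally have card: "card (A <#> set_inv A <#> A) \<le> L * card Y" using trip by linarith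
  have "2 * L \<le> 2 * (c / r ^ 2 ^ n)"
    unfolding L_def using Y r c by (intro mult_left_mono divide_left_mono) auto
  also have "\<dots> = 2 * (c * (4 * (c * inverse \<epsilon>)) ^ 2 ^ n)"
    unfolding r_def using c \<epsilon> by (simp add: field_simps power_divide power_mult_distrib)
  \<comment> \<open>A factor \<open>inverse \<epsilon>\<close>, which is at least 1, is added to
    merge the loose \<open>c\<close> into the power.\<close>
  also have "\<dots> \<le> 2 * (c * inverse \<epsilon> * (4 * (c * inverse \<epsilon>)) ^ 2 ^ n)"
    using c \<epsilon> by (intro mult_left_mono mult_right_mono) (auto simp: field_simps)
  also have "\<dots> = 2 * 4 ^ 2 ^ n * (c * inverse \<epsilon>) ^ (2 ^ n + 1)"
    by (simp add: power_mult_distrib mult_ac)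
  also have "\<dots> = 2 * 4 ^ 2 ^ n * (c * inverse \<epsilon>) powr real (2 ^ n + 1)"
    using c \<epsilon> by (subst powr_realpow) auto
  finally have bound: "2 * L \<le> 2 * 4 ^ 2 ^ n * (c * inverse \<epsilon>) powr real (2 ^ n + 1)" .
  from coset_approximation_of_homogeneous[OF A(1,2) Y(1,2) hom L card \<epsilon>]
  obtain H C D where HCD: "subgroup H G" "H \<subseteq> set_inv A <#> A" "C \<subseteq> A" "A \<subseteq> C <#> H"
    "card C \<le> 2 * L" "D \<subseteq> C" "card (sym_diff A (D <#> H)) < \<epsilon> * card H"
    by blast
  have "card C \<le> 2 * 4 ^ 2 ^ n * (c * inverse \<epsilon>) powr real (2 ^ n + 1)"
    using HCD(5) bound by linarith
  with HCD show "\<exists>H. subgroup H G \<and> H \<subseteq> set_inv A <#> A \<and>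
      (\<exists>C\<subseteq>A. A \<subseteq> C <#> H \<and>
         real (card C) \<le> 2 * 4 ^ 2 ^ n * (c * inverse \<epsilon>) powr real (2 ^ n + 1) \<and>
         (\<exists>D\<subseteq>C. real (card (sym_diff A (D <#> H))) < \<epsilon> * real (card H)))"
    by blast
qed

end

section \<open>Transfer from countable groups\<close>

text \<open>Every generated element is the value of a finite word over \<open>X\<close> and its
  inverses.\<close>

lemma (in group) countable_generate:
  assumes "countable X" "X \<subseteq> carrier G"
  shows "countable (generate G X)"
proof -
  define W where "W = X \<union> (\<lambda>x. inv x) ` X"
  define f where "f = (\<lambda>xs. foldr (\<otimes>) xs \<one>)"
  have W: "W \<subseteq> carrier G" "countable W" using assms by (auto simp: W_def)
  have fc: "f xs \<in> carrier G" if "xs \<in> lists W" for xs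
    using that W by (induction xs) (auto simp: f_def)
  have f_append: "f (xs @ ys) = f xs \<otimes> f ys" if "xs \<in> lists W" "ys \<in> lists W" for xs ys
    using that(1)
  proof (induction xs)
    case Nil
    then show ?case using fc[OF that(2)] by (simp add: f_def)
  next
    case (Cons x xs)
    then have "f (xs @ ys) = f xs \<otimes> f ys" "x \<in> carrier G" "f xs \<in> carrier G"
      using W fc by auto
    then show ?case using fc[OF that(2)] by (simp add: f_def m_assoc)
  qed
  have letter: "w \<in> f ` lists W" if "w \<in> W" for w
    using that W by (intro image_eqI[of _ _ "[w]"]) (auto simp: f_def)
  have "generate G X \<subseteq> f ` lists W"
  proof
    fix g assume "g \<in> generate G X"
    then show "g \<in> f ` lists W"
    proof induction
      case one
      show ?case by (intro image_eqI[of _ _ "[]"]) (auto simp: f_def)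
    next
      case (eng h1 h2)
      then obtain xs ys where "xs \<in> lists W" "ys \<in> lists W" "h1 = f xs" "h2 = f ys" by auto
      then show ?case by (intro image_eqI[of _ _ "xs @ ys"]) (auto simp: f_append)
    next
      case (incl h)
      then have "h \<in> W" by (simp add: W_def)
      then show ?case by (rule letter)
    next
      case (inv h)
      then have "inv h \<in> W" by (simp add: W_def)
      then show ?case by (rule letter)
    qed
  qed
  with W(2) show ?thesis by (meson countable_image countable_lists countable_subset)
qed

text \<open>The group structure is transported along an injection of \<open>S\<close> into
  \<open>nat\<close>.\<close>

lemma (in group) countable_subgroup_embedding:
  assumes "subgroup S G" "countable S"
  obtains G' :: "nat monoid" and \<phi> where "group G'" "\<phi> \<in> hom G' G" "inj_on \<phi> (carrier G')"
    "\<phi> ` carrier G' = S"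
proof -
  interpret S: subgroup S G by fact
  obtain f :: "'a \<Rightarrow> nat" where f: "inj_on f S" using assms(2) by (auto simp: countable_def)
  define \<phi> where "\<phi> = inv_into S f"
  define G' where "G' = \<lparr>carrier = f ` S, mult = (\<lambda>x y. f (\<phi> x \<otimes> \<phi> y)), one = f \<one>\<rparr>"
  have \<phi>f: "\<phi> (f x) = x" if "x \<in> S" for x using that f by (simp add: \<phi>_def)
  have "group G'"
  proof (rule groupI)
    fix x y z assume "x \<in> carrier G'" "y \<in> carrier G'" "z \<in> carrier G'"
    then show "x \<otimes>\<^bsub>G'\<^esub> y \<otimes>\<^bsub>G'\<^esub> z = x \<otimes>\<^bsub>G'\<^esub> (y \<otimes>\<^bsub>G'\<^esub> z)"
      by (auto simp: G'_def \<phi>f m_assoc)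
  next
    fix x assume "x \<in> carrier G'"
    then obtain u where u: "u \<in> S" "x = f u" by (auto simp: G'_def)
    then show "\<exists>y\<in>carrier G'. y \<otimes>\<^bsub>G'\<^esub> x = \<one>\<^bsub>G'\<^esub>"
      by (intro bexI[of _ "f (inv u)"]) (auto simp: G'_def \<phi>f)
  qed (auto simp: G'_def \<phi>f)
  moreover have "\<phi> \<in> hom G' G" by (auto simp: hom_def G'_def \<phi>f)
  moreover have "inj_on \<phi> (carrier G')" by (auto simp: inj_on_def G'_def \<phi>f)
  moreover have "\<phi> ` carrier G' = S" by (auto simp: G'_def \<phi>f image_image)
  ultimately show thesis by (rule that)
qed

lemma (in group_hom) image_set_mult:
  "X \<subseteq> carrier G \<Longrightarrow> Y \<subseteq> carrier G \<Longrightarrow> h ` (X <#>\<^bsub>G\<^esub> Y) = h ` X <#>\<^bsub>H\<^esub> h ` Y"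
  unfolding set_mult_def by (fastforce simp: subset_iff image_iff)

lemma (in group_hom) image_set_inv:
  "X \<subseteq> carrier G \<Longrightarrow> h ` (set_inv\<^bsub>G\<^esub> X) = set_inv\<^bsub>H\<^esub> (h ` X)"
  unfolding SET_INV_def by (fastforce simp: subset_iff image_iff)

text \<open>A forbidden configuration for \<open>A\<close> is mapped to one for its image;
  injectivity keeps products outside \<open>A\<close> outside the image.\<close>

lemma (in group_hom) k_stable_vimage:
  assumes "k_stable H k (h ` A)" "inj_on h (carrier G)" "A \<subseteq> carrier G"
  shows "k_stable G k A"
proof (rule ccontr)
  assume "\<not> k_stable G k A"
  then obtain a b where ab: "\<forall>i\<in>{1..k}. a i \<in> carrier G \<and> b i \<in> carrier G"
      "\<forall>i\<in>{1..k}. \<forall>j\<in>{1..k}. a i \<otimes>\<^bsub>G\<^esub> b j \<in> A \<longleftrightarrow> i \<le> j"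
    unfolding k_stable_def by blast
  have "h (a i) \<otimes>\<^bsub>H\<^esub> h (b j) \<in> h ` A \<longleftrightarrow> i \<le> j" if "i \<in> {1..k}" "j \<in> {1..k}" for i j
  proof -
    have c: "a i \<in> carrier G" "b j \<in> carrier G" using that ab(1) by auto
    then have "h (a i) \<otimes>\<^bsub>H\<^esub> h (b j) \<in> h ` A \<longleftrightarrow> h (a i \<otimes>\<^bsub>G\<^esub> b j) \<in> h ` A" by simp
    also have "\<dots> \<longleftrightarrow> a i \<otimes>\<^bsub>G\<^esub> b j \<in> A"
      using c assms(2,3) by (intro inj_on_image_mem_iff) auto
    finally show ?thesis using ab(2) that by blast
  qed
  then have "\<forall>i\<in>{1..k}. \<forall>j\<in>{1..k}. h (a i) \<otimes>\<^bsub>H\<^esub> h (b j) \<in> h ` A \<longleftrightarrow> i \<le> j"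
    by (intro ballI)
  moreover have "\<forall>i\<in>{1..k}. h (a i) \<in> carrier H \<and> h (b i) \<in> carrier H"
    using ab(1) by simp
  ultimately have "\<not> k_stable H k (h ` A)"
    unfolding k_stable_def not_not
    by - (rule exI[of _ "\<lambda>i. h (a i)"], rule exI[of _ "\<lambda>i. h (b i)"], rule conjI)
  with assms(1) show False by contradiction
qed

text \<open>\<open>A\<close> is pulled back to a copy on \<open>nat\<close> of the subgroup it
  generates, and \<open>H\<close>, \<open>C\<close>, \<open>D\<close> are pushed forward.
  Injectivity preserves all cardinalities and the symmetric difference.\<close>

lemma suitable_consts_transfer:
  fixes G :: "('a, 'b) monoid_scheme"
  assumes nat_groups: "\<And>G' :: nat monoid. group G' \<Longrightarrow> suitable_consts G' k K N" and "group G"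
  shows "suitable_consts G k K N"
  unfolding suitable_consts_def
proof (intro allI impI)
  fix c \<epsilon> :: real and A :: "'a set"
  assume c: "1 \<le> c" and A: "A \<subseteq> carrier G" "finite A" "A \<noteq> {}" and st: "k_stable G k A"
    and trip: "real (card (A <#>\<^bsub>G\<^esub> set_inv\<^bsub>G\<^esub> A <#>\<^bsub>G\<^esub> A)) \<le> c * real (card A)"
    and \<epsilon>: "0 < \<epsilon>" "\<epsilon> \<le> 1 / 2"
  interpret G: group G by fact
  obtain G' :: "nat monoid" and \<phi> where G': "group G'" "\<phi> \<in> hom G' G" "inj_on \<phi> (carrier G')"
      "\<phi> ` carrier G' = generate G A"
    using G.countable_subgroup_embedding[OF G.generate_is_subgroup G.countable_generate] A
    by (metis countable_finite)
  interpret emb: group_hom G' G \<phi>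
    using G' \<open>group G\<close> by (simp add: group_hom_def group_hom_axioms_def)
  have "A \<subseteq> \<phi> ` carrier G'" unfolding G'(4) by (auto intro: generate.incl)
  then obtain B where B: "B \<subseteq> carrier G'" "A = \<phi> ` B" by (auto simp: subset_image_iff)
  have inj: "inj_on \<phi> X" if "X \<subseteq> carrier G'" for X
    using that G'(3) inj_on_subset by blast
  have card: "card (\<phi> ` X) = card X" if "X \<subseteq> carrier G'" for X
    using inj[OF that] by (rule card_image)
  have invB: "set_inv\<^bsub>G'\<^esub> B \<subseteq> carrier G'" using B by (auto simp: SET_INV_def)
  have tripB: "real (card (B <#>\<^bsub>G'\<^esub> set_inv\<^bsub>G'\<^esub> B <#>\<^bsub>G'\<^esub> B)) \<le> c * real (card B)"
  proof -
    have "\<phi> ` (B <#>\<^bsub>G'\<^esub> set_inv\<^bsub>G'\<^esub> B <#>\<^bsub>G'\<^esub> B) = A <#>\<^bsub>G\<^esub> set_inv\<^bsub>G\<^esub> A <#>\<^bsub>G\<^esub> A"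
      using B invB by (simp add: emb.image_set_mult emb.image_set_inv emb.G.set_mult_closed)
    moreover have "B <#>\<^bsub>G'\<^esub> set_inv\<^bsub>G'\<^esub> B <#>\<^bsub>G'\<^esub> B \<subseteq> carrier G'"
      using B invB by (simp add: emb.G.set_mult_closed)
    ultimately show ?thesis using trip card B by metis
  qed
  have "finite B" using A(2) B inj finite_image_iff by blast
  moreover have "B \<noteq> {}" using A B by auto
  moreover have "k_stable G' k B" using st B G'(3) by (intro emb.k_stable_vimage) auto
  ultimately obtain H C D where H: "subgroup H G'" "H \<subseteq> set_inv\<^bsub>G'\<^esub> B <#>\<^bsub>G'\<^esub> B" "C \<subseteq> B"
      "B \<subseteq> C <#>\<^bsub>G'\<^esub> H" "real (card C) \<le> K * (c * inverse \<epsilon>) powr N" "D \<subseteq> C"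
      "real (card (sym_diff B (D <#>\<^bsub>G'\<^esub> H))) < \<epsilon> * real (card H)"
    using nat_groups[OF G'(1)] c B(1) tripB \<epsilon> unfolding suitable_consts_def by meson
  have Hc: "H \<subseteq> carrier G'" and Cc: "C \<subseteq> carrier G'" and Dc: "D \<subseteq> carrier G'"
    using subgroup.subset[OF H(1)] H(3,6) B(1) by auto
  have DH: "D <#>\<^bsub>G'\<^esub> H \<subseteq> carrier G'" using Dc Hc by (rule emb.G.set_mult_closed)
  show "\<exists>H. subgroup H G \<and> H \<subseteq> set_inv\<^bsub>G\<^esub> A <#>\<^bsub>G\<^esub> A \<and>
      (\<exists>C\<subseteq>A. A \<subseteq> C <#>\<^bsub>G\<^esub> H \<and> real (card C) \<le> K * (c * inverse \<epsilon>) powr N \<and>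
         (\<exists>D\<subseteq>C. real (card (sym_diff A (D <#>\<^bsub>G\<^esub> H))) < \<epsilon> * real (card H)))"
  proof (intro exI conjI)
    show "subgroup (\<phi> ` H) G" using H(1) by (rule emb.subgroup_img_is_subgroup)
    have "\<phi> ` H \<subseteq> \<phi> ` (set_inv\<^bsub>G'\<^esub> B <#>\<^bsub>G'\<^esub> B)" using H(2) by (rule image_mono)
    then show "\<phi> ` H \<subseteq> set_inv\<^bsub>G\<^esub> A <#>\<^bsub>G\<^esub> A"
      using B invB by (simp add: emb.image_set_mult emb.image_set_inv)
    show "\<phi> ` C \<subseteq> A" using H(3) B by auto
    have "\<phi> ` B \<subseteq> \<phi> ` (C <#>\<^bsub>G'\<^esub> H)" using H(4) by (rule image_mono)
    then show "A \<subseteq> \<phi> ` C <#>\<^bsub>G\<^esub> \<phi> ` H" using B Cc Hc by (simp add: emb.image_set_mult)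
    show "real (card (\<phi> ` C)) \<le> K * (c * inverse \<epsilon>) powr N" using H(5) card[OF Cc] by simp
    show "\<phi> ` D \<subseteq> \<phi> ` C" using H(6) by (rule image_mono)
    have "sym_diff A (\<phi> ` D <#>\<^bsub>G\<^esub> \<phi> ` H) = \<phi> ` (sym_diff B (D <#>\<^bsub>G'\<^esub> H))"
      unfolding B(2) emb.image_set_mult[OF Dc Hc, symmetric] image_Un
      using B(1) DH by (simp add: inj_on_image_set_diff[OF G'(3)] subset_iff)
    moreover have "sym_diff B (D <#>\<^bsub>G'\<^esub> H) \<subseteq> carrier G'" using B DH by auto
    ultimately show "real (card (sym_diff A (\<phi> ` D <#>\<^bsub>G\<^esub> \<phi> ` H))) < \<epsilon> * real (card (\<phi> ` H))"
      using H(7) card Hc by simp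
  qed
qed

theorem theorem1p6:
  fixes k :: nat
  assumes "k \<ge> 1"
  shows "stable_K k > 0 \<and> stable_N k > 0 \<and>
    (\<forall>(G :: ('a, 'b) monoid_scheme) (c::real) A.
       group G \<longrightarrow> c \<ge> 1 \<longrightarrow> A \<subseteq> carrier G \<longrightarrow> finite A \<longrightarrow> A \<noteq> {} \<longrightarrow> k_stable G k A \<longrightarrow>
       real (card (A <#>\<^bsub>G\<^esub> set_inv\<^bsub>G\<^esub> A <#>\<^bsub>G\<^esub> A)) \<le> c * real (card A) \<longrightarrow>
       (\<forall>\<epsilon>::real. 0 < \<epsilon> \<longrightarrow> \<epsilon> \<le> 1 / 2 \<longrightarrow>
          (\<exists>H. subgroup H G \<and> H \<subseteq> set_inv\<^bsub>G\<^esub> A <#>\<^bsub>G\<^esub> A \<and>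
             (\<exists>C\<subseteq>A. A \<subseteq> C <#>\<^bsub>G\<^esub> H \<and>
                real (card C) \<le> stable_K k * (c * inverse \<epsilon>) powr stable_N k \<and>
                (\<exists>D\<subseteq>C. real (card (sym_diff A (D <#>\<^bsub>G\<^esub> H))) < \<epsilon> * real (card H))))))"
proof -
  let ?ok = "\<lambda>(K, N). K > 0 \<and> N > 0 \<and> (\<forall>G :: nat monoid. group G \<longrightarrow> suitable_consts G k K N)"
  have "?ok (2 * 4 ^ 2 ^ (2 ^ Suc k - 2), real (2 ^ (2 ^ Suc k - 2) + 1))"
    using group.suitable_consts_explicit by (simp del: power_Suc of_nat_add of_nat_power) blast
  then have "?ok (stable_consts k)" unfolding stable_consts_def by (rule someI)
  then have const_props: "stable_K k > 0" "stable_N k > 0"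
      "\<And>G :: nat monoid. group G \<Longrightarrow> suitable_consts G k (stable_K k) (stable_N k)"
    by (auto simp: stable_K_def stable_N_def split: prod.splits)
  \<comment> \<open>The chosen constants come with a guarantee for groups on \<open>nat\<close>
    only; the transfer extends it to all types.\<close>
  have suit: "suitable_consts G k (stable_K k) (stable_N k)" if "group G"
    for G :: "('a, 'b) monoid_scheme"
    using const_props(3) that by (rule suitable_consts_transfer)
  show ?thesis
    by (intro conjI allI impI const_props(1,2))
      (rule suit[unfolded suitable_consts_def, rule_format])
qed

end
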